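(* The set $(\mathcal{P}\times\mathcal{P})^-$ of reduced two-color partitions forms an abelian group under two-color concatenation $\cup^2$.
   Context: A partition is a finite weakly decreasing sequence of positive integers (its parts); the empty partition $\emptyset$ is allowed. A two-color partition is a partition in which each part is assigned one of two colors, white or gray; the order of equal-size parts is irrelevant, so a two-color partition is the same as a pair (white sub-partition, gray sub-partition) in $\mathcal{P}\times\mathcal{P}$, where $\mathcal{P}$ is the set of all partitions. Two-color reduction is the unary operation that removes from a two-color partition each pair of parts of the same size and different colors (one white part together with one gray part of equal size, repeatedly, until no such pair is left). A two-color partition is reduced if it contains no pair of parts of the same size and different colors; $(\mathcal{P}\times\mathcal{P})^-$ denotes the set of all reduced two-color partitions. For $\lambda,\pi\in(\mathcal{P}\times\mathcal{P})^-$, the two-color concatenation $\lambda\cup^2\pi$ is obtained by concatenating the (colored) parts of $\lambda$ and $\pi$, reordering so that parts are weakly decreasing in size, and then applying two-color reduction. *)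

theory Defs
  imports "HOL-Algebra.Group" "HOL-Library.Multiset"
begin

definition partitions :: "nat list set" where
  "partitions = {xs. sorted_wrt (\<ge>) xs \<and> (\<forall>k \<in> set xs. 0 < k)}"

text \<open>A two-color partition is the pair of its white and its gray sub-partition.\<close>

type_synonym two_color = "nat list \<times> nat list"

definition two_color_partitions :: "two_color set" where
  "two_color_partitions = partitions \<times> partitions"

definition is_reduced :: "two_color \<Rightarrow> bool" where
  "is_reduced p \<longleftrightarrow> \<not> (\<exists>k. k \<in> set (fst p) \<and> k \<in> set (snd p))"

definition reduced_two_color_partitions :: "two_color set" where
  "reduced_two_color_partitions = {p \<in> two_color_partitions. is_reduced p}"

text \<open>One step removes a single white part together with a single gray part of equal size.\<close>

inductive remove_pair :: "two_color \<Rightarrow> two_color \<Rightarrow> bool" where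
  "k \<in> set w \<Longrightarrow> k \<in> set g \<Longrightarrow> remove_pair (w, g) (remove1 k w, remove1 k g)"

text \<open>Steps are iterated until no such pair is left; the outcome does not depend on the order
  of the removals, see \<open>two_color_reduction_unique\<close> below.\<close>

definition two_color_reduction :: "two_color \<Rightarrow> two_color" where
  "two_color_reduction p = (THE q. remove_pair\<^sup>*\<^sup>* p q \<and> is_reduced q)"

definition reorder :: "nat list \<Rightarrow> nat list" where
  "reorder xs = rev (sort xs)"

definition two_color_concat :: "two_color \<Rightarrow> two_color \<Rightarrow> two_color"  (infixl "\<union>\<^sup>2" 65) where
  "p \<union>\<^sup>2 q = two_color_reduction (reorder (fst p @ fst q), reorder (snd p @ snd q))"

lemma reorder_in_partitions:
  assumes "xs \<in> partitions" "ys \<in> partitions"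
  shows "reorder (xs @ ys) \<in> partitions"
  using assms by (auto simp: partitions_def reorder_def sorted_wrt_rev)

lemma mset_reorder: "mset (reorder xs) = mset xs"
  by (simp add: reorder_def)

lemma partitions_eqI:
  assumes "xs \<in> partitions" "ys \<in> partitions" "mset xs = mset ys"
  shows "xs = ys"
proof -
  have "sorted (rev xs)" "sorted (rev ys)"
    using assms(1,2) by (auto simp: partitions_def sorted_wrt_rev)
  then have "rev xs = rev ys"
    using assms(3) by (metis mset_rev properties_for_sort)
  then show ?thesis by simp
qed

lemma remove1_in_partitions: "xs \<in> partitions \<Longrightarrow> remove1 k xs \<in> partitions"
proof (induction xs)
  case (Cons a xs)
  then show ?case
    using set_remove1_subset[of k xs] by (auto simp: partitions_def)
qed (simp add: partitions_def)

lemma remove_pair_invariant: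
  assumes "remove_pair\<^sup>*\<^sup>* p q" "p \<in> two_color_partitions"
  shows "q \<in> two_color_partitions \<and>
    mset (fst q) - mset (snd q) = mset (fst p) - mset (snd p) \<and>
    mset (snd q) - mset (fst q) = mset (snd p) - mset (fst p)"
  using assms
proof (induction rule: rtranclp_induct)
  case (step q r)
  then show ?case
    by (auto elim!: remove_pair.cases simp: two_color_partitions_def remove1_in_partitions)
qed simp

lemma remove_pair_terminates: "\<exists>q. remove_pair\<^sup>*\<^sup>* p q \<and> is_reduced q"
proof (induction "length (fst p)" arbitrary: p rule: less_induct)
  case less
  show ?case
  proof (cases "is_reduced p")
    case False
    then obtain k where k: "k \<in> set (fst p)" "k \<in> set (snd p)"
      by (auto simp: is_reduced_def)
    define r where "r = (remove1 k (fst p), remove1 k (snd p))"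
    have "remove_pair p r"
      using remove_pair.intros[OF k] by (simp add: r_def)
    moreover have "length (fst r) < length (fst p)"
      using k length_pos_if_in_set[OF k(1)] by (simp add: r_def length_remove1)
    then obtain q where "remove_pair\<^sup>*\<^sup>* r q" "is_reduced q"
      using less by blast
    ultimately show ?thesis
      by (meson converse_rtranclp_into_rtranclp)
  qed blast
qed

lemma is_reduced_mset:
  assumes "is_reduced q"
  shows "mset (fst q) - mset (snd q) = mset (fst q)" "mset (snd q) - mset (fst q) = mset (snd q)"
  using assms by (auto simp: is_reduced_def disjunct_not_in intro!: multiset_eqI)
    (metis count_eq_zero_iff diff_zero set_mset_mset diff_0_eq_0)+

lemma two_color_reduction_unique:
  assumes "p \<in> two_color_partitions"
  shows "\<exists>!q. remove_pair\<^sup>*\<^sup>* p q \<and> is_reduced q"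
proof (rule ex_ex1I[OF remove_pair_terminates])
  fix q r
  assume q: "remove_pair\<^sup>*\<^sup>* p q \<and> is_reduced q" and r: "remove_pair\<^sup>*\<^sup>* p r \<and> is_reduced r"
  have "mset (fst q) = mset (fst r)" "mset (snd q) = mset (snd r)"
    using remove_pair_invariant[of p q] remove_pair_invariant[of p r]
      is_reduced_mset[of q] is_reduced_mset[of r] q r assms by simp_all
  then show "q = r"
    using remove_pair_invariant[of p q] remove_pair_invariant[of p r] q r assms
    by (auto simp: two_color_partitions_def intro!: prod_eqI partitions_eqI)
qed

lemma two_color_reduction_eqI:
  assumes "p \<in> two_color_partitions" "remove_pair\<^sup>*\<^sup>* p q" "is_reduced q"
  shows "two_color_reduction p = q"
  unfolding two_color_reduction_def
  using two_color_reduction_unique[OF assms(1)] assms(2,3) by (simp add: the1_equality)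

lemma two_color_reduction_mset:
  assumes "p \<in> two_color_partitions"
  shows "two_color_reduction p \<in> reduced_two_color_partitions"
    and "mset (fst (two_color_reduction p)) = mset (fst p) - mset (snd p)"
    and "mset (snd (two_color_reduction p)) = mset (snd p) - mset (fst p)"
proof -
  have q: "remove_pair\<^sup>*\<^sup>* p (two_color_reduction p) \<and> is_reduced (two_color_reduction p)"
    unfolding two_color_reduction_def by (rule theI'[OF two_color_reduction_unique[OF assms]])
  show "two_color_reduction p \<in> reduced_two_color_partitions"
    "mset (fst (two_color_reduction p)) = mset (fst p) - mset (snd p)"
    "mset (snd (two_color_reduction p)) = mset (snd p) - mset (fst p)"
    using q remove_pair_invariant[of p "two_color_reduction p"] assms
      is_reduced_mset[of "two_color_reduction p"]
    by (simp_all add: reduced_two_color_partitions_def)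
qed

end

theory Submission
  imports Defs
begin

text \<open>A reduced two-color partition is determined by the function sending each size to the number
  of white parts minus the number of gray parts of that size. Reduction does not change this
  function and concatenation adds it, so the group laws are inherited from the integers.\<close>

definition excess :: "two_color \<Rightarrow> nat \<Rightarrow> int" where
  "excess p k = int (count (mset (fst p)) k) - int (count (mset (snd p)) k)"

lemma excess_empty: "excess ([], []) k = 0"
  by (simp add: excess_def)

lemma excess_swap: "excess (prod.swap p) k = - excess p k"
  by (simp add: excess_def)

text \<open>Reduction leaves the truncated differences \<open>a - b\<close> white and
  \<open>b - a\<close> gray parts of each size. At most one of them is nonzero, and their integer
  difference is again \<open>a - b\<close>.\<close>

lemma excess_reduction:
  assumes "p \<in> two_color_partitions"
  shows "excess (two_color_reduction p) k = excess p k"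
  unfolding excess_def two_color_reduction_mset(2,3)[OF assms] by simp

lemma reordered_append_in_two_color_partitions:
  assumes "p \<in> two_color_partitions" "q \<in> two_color_partitions"
  shows "(reorder (fst p @ fst q), reorder (snd p @ snd q)) \<in> two_color_partitions"
  using assms by (auto simp: two_color_partitions_def intro: reorder_in_partitions)

lemma reduced_imp_two_color_partition:
  "p \<in> reduced_two_color_partitions \<Longrightarrow> p \<in> two_color_partitions"
  by (simp add: reduced_two_color_partitions_def)

lemma two_color_concat_closed:
  assumes "p \<in> two_color_partitions" "q \<in> two_color_partitions"
  shows "p \<union>\<^sup>2 q \<in> reduced_two_color_partitions"
  unfolding two_color_concat_def
  using assms by (intro two_color_reduction_mset(1) reordered_append_in_two_color_partitions)

lemma excess_concat:
  assumes "p \<in> two_color_partitions" "q \<in> two_color_partitions"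
  shows "excess (p \<union>\<^sup>2 q) k = excess p k + excess q k"
  unfolding two_color_concat_def
    excess_reduction[OF reordered_append_in_two_color_partitions[OF assms]]
  by (simp add: excess_def mset_reorder)

text \<open>Each size occurs in at most one color, so the sign of the excess tells which color it is
  and its absolute value how often. \<open>nat\<close> sends the negative case to 0.\<close>

lemma reduced_count_conv_excess:
  assumes "is_reduced p"
  shows "count (mset (fst p)) k = nat (excess p k)"
    and "count (mset (snd p)) k = nat (- excess p k)"
proof -
  have "count (mset (fst p)) k = 0 \<or> count (mset (snd p)) k = 0"
    using assms by (auto simp: is_reduced_def count_eq_zero_iff)
  then show "count (mset (fst p)) k = nat (excess p k)"
    and "count (mset (snd p)) k = nat (- excess p k)"
    unfolding excess_def by linarith+
qed

text \<open>The excess recovers both multisets of parts, and a weakly decreasing list is determined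
  by its multiset. This turns each group law into an identity of integers.\<close>

lemma reduced_eqI:
  assumes "p \<in> reduced_two_color_partitions" "q \<in> reduced_two_color_partitions"
    and "\<And>k. excess p k = excess q k"
  shows "p = q"
proof (intro prod_eqI partitions_eqI multiset_eqI)
  fix k
  show "count (mset (fst p)) k = count (mset (fst q)) k"
    "count (mset (snd p)) k = count (mset (snd q)) k"
    using assms by (simp_all only: reduced_two_color_partitions_def mem_Collect_eq
        reduced_count_conv_excess)
qed (use assms(1,2) in \<open>auto simp: reduced_two_color_partitions_def two_color_partitions_def\<close>)

lemma empty_reduced: "([], []) \<in> reduced_two_color_partitions"
  by (simp add: reduced_two_color_partitions_def two_color_partitions_def partitions_def
      is_reduced_def)

lemma swap_reduced:
  "p \<in> reduced_two_color_partitions \<Longrightarrow> prod.swap p \<in> reduced_two_color_partitions"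
  by (auto simp: reduced_two_color_partitions_def two_color_partitions_def is_reduced_def)

theorem theorem3:
  "comm_group \<lparr>carrier = reduced_two_color_partitions,
               monoid.mult = two_color_concat,
               one = ([], [])\<rparr>"
proof (rule comm_groupI, simp_all only: partial_object.simps monoid.simps)
  \<comment> \<open>With these rules \<open>simp\<close> proves the membership premises of
    \<open>reduced_eqI\<close>, also for nested concatenations, and evaluates the excess of both
    sides.\<close>
  note [simp] = reduced_imp_two_color_partition two_color_concat_closed excess_concat
    excess_empty excess_swap empty_reduced swap_reduced
  fix p q r
  assume p: "p \<in> reduced_two_color_partitions"
  show "([], []) \<union>\<^sup>2 p = p"
    using p by (intro reduced_eqI) simp_all
  \<comment> \<open>Exchanging the colors negates the excess, which gives the inverse. A left
    inverse suffices for \<open>comm_groupI\<close>.\<close>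
  have "prod.swap p \<union>\<^sup>2 p = ([], [])"
    using p by (intro reduced_eqI) simp_all
  then show "\<exists>y\<in>reduced_two_color_partitions. y \<union>\<^sup>2 p = ([], [])"
    using swap_reduced[OF p] by blast
  assume q: "q \<in> reduced_two_color_partitions"
  show "p \<union>\<^sup>2 q \<in> reduced_two_color_partitions"
    using p q by simp
  show "p \<union>\<^sup>2 q = q \<union>\<^sup>2 p"
    using p q by (intro reduced_eqI) simp_all
  assume r: "r \<in> reduced_two_color_partitions"
  show "p \<union>\<^sup>2 q \<union>\<^sup>2 r = p \<union>\<^sup>2 (q \<union>\<^sup>2 r)"
    using p q r by (intro reduced_eqI) simp_all
qed (rule empty_reduced)

end
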